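(* Let $N\ge 3$ and let $\mathcal X=\{x_1<\cdots<x_{N+1}\}\subseteq[\underline x,\overline x]$ be a fixed set of breakpoints with $x_1=\underline x$, $x_{N+1}=\overline x$. Assume that the decision maker's true utility function is normalized piecewise-linear, $u^*(x)=(R\mathbf v^* )^\top\mathbf g(x)$, with the true increment vector $\mathbf v^*\in\mathbb R_+^{N-1}$ contained in the initial bounded polyhedron $\mathcal P^0$. Let $\mathcal P^{k,i}$ ($k\ge0$, $i\in\{1,\dots,N-1\}$) be the ambiguity polyhedron obtained after $k(N-1)+i$ queries of the coordinate-wise polyhedral method (CPM) described in the context, let $$\mathcal U_{\mathcal X}^{k,i}:=\{u: u(x)=(R\mathbf v)^\top\mathbf g(x),\ \mathbf v\in\mathcal P^{k,i}\},$$ let $\mathcal B^0$ be the minimum enclosing ball of $\mathcal P^0$ with radius $r(\mathcal B^0)$, and $\delta:=\overline x-\underline x$. Then for each $k\ge0$, $i\in\{1,\dots,N-1\}$ and $u\in\mathcal U^{k,i}_{\mathcal X}$, $$d_K(u^*,u)\le d_I(u^*,u)\le\sup_{u',u''\in\mathcal U^{k,i}_{\mathcal X}}d_I(u',u'')=\sup_{u',u''\in\mathcal U^{k,i}_{\mathcal X}}\delta\|u'-u''\|_\infty\le2\delta\sqrt{N-1}\;r(\mathcal B^0)\left(\sqrt{\frac{N-2}{N-1}}\right)^{k}.$$ In particular, $\sup_{u\in\mathcal U^{k,i}_{\mathcal X}}d_K(u^*,u)\to0$ and $\sup_{u\in\mathcal U^{k,i}_{\mathcal X}}d_I(u^*,u)\to0$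 as $k\to\infty$.
   Context: **Notation.** $R:\mathbb R^{N-1}\to\mathbb R^N$, $R\mathbf y=(\mathbf y,1-\mathbf e^\top\mathbf y)$, $\mathbf e$ all-ones. The basis mapping $\mathbf g:[\underline x,\overline x]\to\mathbb R^N$ is $\mathbf g(x_1)=0$ and $\mathbf g(x)=(1,\dots,1,\frac{x-x_i}{x_{i+1}-x_i},0,\dots,0)^\top$ (with $i-1$ ones) for $x\in(x_i,x_{i+1}]$, $i=1,\dots,N$. Thus $(R\mathbf v)^\top\mathbf g$ is the piecewise-linear function with breakpoints $\mathcal X$, value $0$ at $\underline x$, $1$ at $\overline x$, and increments $R\mathbf v$; the true utility $u^*$ is nondecreasing. **Distances.** $d_K(u,v)=\sup_\varphi\left[\int_{\underline x}^{\overline x}\varphi\,du-\int_{\underline x}^{\overline x}\varphi\,dv\right]$ over all 1-Lipschitz $\varphi:[\underline x,\overline x]\to\mathbb R$ (Kantorovich), and $d_I(u,v)=(\overline x-\underline x)\|u-v\|_\infty$ (scaled Kolmogorov); these formulas are used for normalized ($u(\underline x)=0,u(\overline x)=1$) piecewise-linear functions. **Initial set.** $\mathcal P^0=\{\mathbf v\in\mathbb R_+^{N-1}:\mathbf A\mathbf v\le\mathbf b\}$ is bounded. **CPM** (run for all $k=0,1,2,\dots$ without stopping). The minimum enclosing ball (MEB) of a bounded set is the smallest-radius closed Euclidean ball containing it. At major iteration $k$: let $\mathbf c^k$ be the center of the MEB of $\mathcal P^k$; choose an arbitrary orthonormal basis $\boldsymbol\alpha^{k,1},\dots,\boldsymbol\alpha^{k,N-1}$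 of $\mathbb R^{N-1}$; put $\mathcal P^{k,0}=\mathcal P^k$. For $i=1,\dots,N-1$ ask a query of two lotteries $A=\{(r^A_s,p^A_s)\}_s$, $B=\{(r^B_s,p^B_s)\}_s$ (finitely many outcomes in $[\underline x,\overline x]$ with probabilities) having $\{\mathbf v:(\boldsymbol\alpha^{k,i})^\top(\mathbf v-\mathbf c^k)=0\}$ as separating hyperplane: with $\mathbf G^A=\sum_sp^A_s\mathbf g(r^A_s)$, $\mathbf G^B=\sum_sp^B_s\mathbf g(r^B_s)$ one has, for some $\gamma>0$, $G^A_N-G^B_N=-\gamma(\boldsymbol\alpha^{k,i})^\top\mathbf c^k$ and $G^A_j-G^B_j=(G^A_N-G^B_N)+\gamma\alpha_j^{k,i}$ for $j\le N-1$ (so $(R\mathbf v)^\top(\mathbf G^A-\mathbf G^B)=\gamma(\boldsymbol\alpha^{k,i})^\top(\mathbf v-\mathbf c^k)$). The decision maker answers without error according to expected utility: $\mu^{k,i}=-1$ if $(R\mathbf v^* )^\top\mathbf G^A\ge(R\mathbf v^* )^\top\mathbf G^B$, $\mu^{k,i}=1$ otherwise, and $$\mathcal P^{k,i}=\mathcal P^{k,i-1}\cap\{\mathbf v:\mu^{k,i}(R\mathbf v)^\top(\mathbf G^A-\mathbf G^B)\le0\}.$$ Finally $\mathcal P^{k+1}=\mathcal P^{k,N-1}$. *)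

theory Defs
  imports "HOL-Probability.Probability"
begin

text \<open>
  Throughout, \<open>CARD('n) = N - 1\<close>, the space \<open>real ^ 'n\<close> is $\mathbb{R}^{N-1}$ and the product
  \<open>real ^ 'n \<times> real\<close>, with its product inner product, is $\mathbb{R}^N$: its first component holds the
  coordinates \<open>1, \<dots>, N - 1\<close> and its second component the \<open>N\<close>-th coordinate.
  As the coordinates of the basis mapping are ordered, \<open>'n\<close> is linearly ordered, and \<open>pos j\<close> is
  the number in \<open>{1..N - 1}\<close> of the coordinate \<open>j\<close>.
  Breakpoints are \<open>x 1 < \<dots> < x (N + 1)\<close>; other values of \<open>x\<close> are irrelevant.
  Utilities are functions on \<open>real\<close> of which only the restriction to the interval matters.
\<close>

definition pos :: "'n::{finite,linorder} \<Rightarrow> nat" where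
  "pos j = card {i. i \<le> j}"

definition increments :: "real ^ 'n \<Rightarrow> (real ^ 'n) \<times> real" where
  "increments v = (v, 1 - (\<Sum>j\<in>UNIV. v $ j))"

definition basis_coord :: "nat \<Rightarrow> (nat \<Rightarrow> real) \<Rightarrow> real \<Rightarrow> nat \<Rightarrow> real" where
  "basis_coord N x t j =
     (if t = x 1 then 0
      else let i = (THE i. i \<in> {1..N} \<and> t \<in> {x i <.. x (i + 1)})
           in if j < i then 1
              else if j = i then (t - x i) / (x (i + 1) - x i)
              else 0)"

definition basis_map :: "(nat \<Rightarrow> real) \<Rightarrow> real \<Rightarrow> (real ^ 'n::{finite,linorder}) \<times> real" where
  "basis_map x t =
     ((\<chi> j. basis_coord (CARD('n) + 1) x t (pos j)),
      basis_coord (CARD('n) + 1) x t (CARD('n) + 1))"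

definition pl_utility :: "(nat \<Rightarrow> real) \<Rightarrow> real ^ 'n::{finite,linorder} \<Rightarrow> real \<Rightarrow> real" where
  "pl_utility x v t = increments v \<bullet> basis_map x t"

definition pl_utilities ::
    "(nat \<Rightarrow> real) \<Rightarrow> (real ^ 'n::{finite,linorder}) set \<Rightarrow> (real \<Rightarrow> real) set" where
  "pl_utilities x P =
     {u. \<exists>v\<in>P. \<forall>t\<in>{x 1 .. x (CARD('n) + 2)}. u t = pl_utility x v t}"

text \<open>
  The integral with respect to \<open>u\<close> is the Riemann--Stieltjes integral (limit of tagged sums as
  the mesh tends to 0). It exists for continuous integrands and integrators of bounded variation;
  \<open>u\<close> is not required to be monotone, since members of the initial polyhedron may have a
  negative last increment.
\<close>

definition has_stieltjes_integral ::
    "(real \<Rightarrow> real) \<Rightarrow> (real \<Rightarrow> real) \<Rightarrow> real \<Rightarrow> real \<Rightarrow> real \<Rightarrow> bool" where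
  "has_stieltjes_integral f u a b I \<longleftrightarrow>
     (\<forall>e>0. \<exists>h>0. \<forall>p. p tagged_division_of {a..b} \<and> (\<lambda>t. ball t h) fine p \<longrightarrow>
        \<bar>(\<Sum>(t, K)\<in>p. f t * (u (Sup K) - u (Inf K))) - I\<bar> < e)"

definition stieltjes_integral ::
    "real \<Rightarrow> real \<Rightarrow> (real \<Rightarrow> real) \<Rightarrow> (real \<Rightarrow> real) \<Rightarrow> real" where
  "stieltjes_integral a b f u = (THE I. has_stieltjes_integral f u a b I)"

text \<open>Distances take values in the extended reals, so that all suprema are genuine.\<close>

definition dist_K :: "real \<Rightarrow> real \<Rightarrow> (real \<Rightarrow> real) \<Rightarrow> (real \<Rightarrow> real) \<Rightarrow> ereal" where
  "dist_K a b u v =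
     (SUP f\<in>{f :: real \<Rightarrow> real. 1-lipschitz_on {a..b} f}.
        ereal (stieltjes_integral a b f u - stieltjes_integral a b f v))"

definition sup_norm :: "real \<Rightarrow> real \<Rightarrow> (real \<Rightarrow> real) \<Rightarrow> ereal" where
  "sup_norm a b w = (SUP t\<in>{a..b}. ereal \<bar>w t\<bar>)"

definition dist_I :: "real \<Rightarrow> real \<Rightarrow> (real \<Rightarrow> real) \<Rightarrow> (real \<Rightarrow> real) \<Rightarrow> ereal" where
  "dist_I a b u v = ereal (b - a) * sup_norm a b (\<lambda>t. u t - v t)"

definition polyhedron0 :: "real ^ 'n ^ 'm \<Rightarrow> real ^ 'm \<Rightarrow> (real ^ 'n) set" where
  "polyhedron0 A b = {v. (\<forall>j. 0 \<le> v $ j) \<and> (\<forall>i. (A *v v) $ i \<le> b $ i)}"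

definition min_enclosing_ball :: "'a::euclidean_space set \<Rightarrow> 'a \<Rightarrow> real \<Rightarrow> bool" where
  "min_enclosing_ball S c r \<longleftrightarrow>
     0 \<le> r \<and> S \<subseteq> cball c r \<and> (\<forall>c' r'. 0 \<le> r' \<and> S \<subseteq> cball c' r' \<longrightarrow> r \<le> r')"

definition orthonormal_basis :: "nat set \<Rightarrow> (nat \<Rightarrow> 'a::euclidean_space) \<Rightarrow> bool" where
  "orthonormal_basis I w \<longleftrightarrow>
     (\<forall>i\<in>I. \<forall>j\<in>I. w i \<bullet> w j = (if i = j then 1 else 0)) \<and> span (w ` I) = UNIV"

definition lottery :: "real \<Rightarrow> real \<Rightarrow> real pmf \<Rightarrow> bool" where
  "lottery a b L \<longleftrightarrow> finite (set_pmf L) \<and> set_pmf L \<subseteq> {a..b}"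

definition lottery_vec ::
    "(nat \<Rightarrow> real) \<Rightarrow> real pmf \<Rightarrow> (real ^ 'n::{finite,linorder}) \<times> real" where
  "lottery_vec x L = (\<Sum>r\<in>set_pmf L. pmf L r *\<^sub>R basis_map x r)"

text \<open>The two lotteries have the hyperplane through \<open>c\<close> with normal \<open>a\<close> as separating hyperplane.\<close>

definition separating_query ::
    "(nat \<Rightarrow> real) \<Rightarrow> real ^ 'n::{finite,linorder} \<Rightarrow> real ^ 'n::{finite,linorder} \<Rightarrow>
     real pmf \<Rightarrow> real pmf \<Rightarrow> bool" where
  "separating_query x a c LA LB \<longleftrightarrow>
     lottery (x 1) (x (CARD('n) + 2)) LA \<and> lottery (x 1) (x (CARD('n) + 2)) LB \<and>
     (let GA = lottery_vec x LA :: (real ^ 'n::{finite,linorder}) \<times> real;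
          GB = lottery_vec x LB :: (real ^ 'n::{finite,linorder}) \<times> real
      in \<exists>\<gamma>>0. snd GA - snd GB = - \<gamma> * (a \<bullet> c) \<and>
               (\<forall>j. fst GA $ j - fst GB $ j = (snd GA - snd GB) + \<gamma> * a $ j))"

definition answer ::
    "(nat \<Rightarrow> real) \<Rightarrow> real ^ 'n::{finite,linorder} \<Rightarrow> real pmf \<Rightarrow> real pmf \<Rightarrow> real" where
  "answer x v LA LB =
     (if increments v \<bullet> lottery_vec x LA \<ge> increments v \<bullet> lottery_vec x LB then - 1 else 1)"

text \<open>
  \<open>P k i\<close> is the ambiguity set after the \<open>i\<close>-th query of major iteration \<open>k\<close>, so that
  \<open>P k 0\<close> is the set at the start of that iteration. Centers \<open>c\<close>, bases \<open>\<alpha>\<close> and queries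
  \<open>LA\<close>, \<open>LB\<close> are any admissible choices made during the run.
\<close>

definition cpm_run ::
    "(nat \<Rightarrow> real) \<Rightarrow> real ^ 'n::{finite,linorder} \<Rightarrow> (real ^ 'n::{finite,linorder}) set \<Rightarrow>
     (nat \<Rightarrow> nat \<Rightarrow> (real ^ 'n::{finite,linorder}) set) \<Rightarrow>
     (nat \<Rightarrow> real ^ 'n::{finite,linorder}) \<Rightarrow> (nat \<Rightarrow> nat \<Rightarrow> real ^ 'n::{finite,linorder}) \<Rightarrow>
     (nat \<Rightarrow> nat \<Rightarrow> real pmf) \<Rightarrow> (nat \<Rightarrow> nat \<Rightarrow> real pmf) \<Rightarrow> bool" where
  "cpm_run x vstar P0 P c \<alpha> LA LB \<longleftrightarrow>
     P 0 0 = P0 \<and>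
     (\<forall>k. (\<exists>r. min_enclosing_ball (P k 0) (c k) r) \<and>
          orthonormal_basis {1..CARD('n)} (\<alpha> k) \<and>
          (\<forall>i\<in>{1..CARD('n)}.
             separating_query x (\<alpha> k i) (c k) (LA k i) (LB k i) \<and>
             P k i = P k (i - 1) \<inter>
               {v. answer x vstar (LA k i) (LB k i) *
                   (increments v \<bullet> (lottery_vec x (LA k i) - lottery_vec x (LB k i))) \<le> 0}) \<and>
          P (Suc k) 0 = P k CARD('n))"

end

theory Submission
  imports Defs
begin

text \<open>
  In the coordinates of the orthonormal basis, the answers of one major iteration confine the
  increments to one orthant at the center of the enclosing ball. A ball of radius \<open>r\<close> intersected
  with such an orthant lies in a ball of radius \<open>r * sqrt ((N - 2) / (N - 1))\<close>, and the true
  increments are never cut off. The bound on utilities follows from the comparison of the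
  1-norm with the Euclidean norm. For the first inequality, a normalized piecewise-linear utility
  has a step function as density; integration by parts turns the integral of a 1-Lipschitz
  function against the difference of two utilities into one of that difference against the
  Lipschitz function.
\<close>

subsection \<open>Shrinking of the enclosing balls\<close>

text \<open>The projection \<open>p\<close> of \<open>y\<close> onto the family has the same inner
  products with all \<open>w i\<close> as \<open>y\<close> has, so \<open>y - p\<close> is
  orthogonal to a spanning set, hence to itself, and is therefore zero.\<close>

lemma orthonormal_basis_Parseval:
  fixes w :: "nat \<Rightarrow> 'a::euclidean_space"
  assumes "orthonormal_basis I w" "finite I"
  shows "(norm y)\<^sup>2 = (\<Sum>i\<in>I. (w i \<bullet> y)\<^sup>2)"
proof -
  define p where "p = (\<Sum>i\<in>I. (w i \<bullet> y) *\<^sub>R w i)"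
  have on: "w i \<bullet> w j = (if i = j then 1 else 0)" if "i \<in> I" "j \<in> I" for i j
    using assms(1) that by (auto simp: orthonormal_basis_def)
  have wp: "w i \<bullet> p = w i \<bullet> y" if "i \<in> I" for i
    using that assms(2) by (simp add: p_def inner_sum_right on if_distrib cong: if_cong)
  have "orthogonal (y - p) u" if "u \<in> w ` I" for u
  proof -
    from that obtain i where i: "i \<in> I" "u = w i" by blast
    have "(y - p) \<bullet> w i = w i \<bullet> y - w i \<bullet> p"
      by (metis inner_commute inner_diff_right)
    with wp i show ?thesis by (simp add: orthogonal_def)
  qed
  moreover have "span (w ` I) = UNIV"
    using assms(1) unfolding orthonormal_basis_def by (rule conjunct2)
  ultimately have "orthogonal (y - p) (y - p)"
    by (intro orthogonal_to_span[of "y - p" "w ` I"]) simp_all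
  then have "y = p"
    by (simp add: orthogonal_self)
  then have "y \<bullet> y = y \<bullet> p" by simp
  also have "\<dots> = (\<Sum>i\<in>I. (w i \<bullet> y)\<^sup>2)"
    by (simp add: p_def inner_sum_right power2_eq_square inner_commute)
  finally show ?thesis by (simp add: power2_norm_eq_inner)
qed

text \<open>The cross terms of the expanded square are nonnegative. This compares the Euclidean norm
  of a vector in an orthant with its component along the diagonal.\<close>

lemma sum_squares_le_square_sum:
  fixes f :: "'i \<Rightarrow> real"
  assumes "finite I" "\<And>i. i \<in> I \<Longrightarrow> 0 \<le> f i"
  shows "(\<Sum>i\<in>I. (f i)\<^sup>2) \<le> (\<Sum>i\<in>I. f i)\<^sup>2"
  using assms
proof (induction I rule: finite_induct)
  case (insert a I)
  have "0 \<le> 2 * f a * sum f I"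
    using insert.prems by (intro mult_nonneg_nonneg sum_nonneg) auto
  moreover have "(\<Sum>i\<in>I. (f i)\<^sup>2) \<le> (sum f I)\<^sup>2"
    using insert by auto
  ultimately show ?case
    using insert.hyps by (simp add: power2_sum)
qed simp

text \<open>
  The new center moves from \<open>c\<close> into the orthant by \<open>r / n\<close> along each axis.
\<close>

lemma orthant_cball_subset_cball:
  fixes w :: "nat \<Rightarrow> 'a::euclidean_space"
  assumes ob: "orthonormal_basis {1..n} w" and n: "2 \<le> n" and "0 \<le> r"
    and s: "\<And>i. i \<in> {1..n} \<Longrightarrow> s i \<in> {-1, 1 :: real}"
  shows "\<exists>c'. {v \<in> cball c r. \<forall>i\<in>{1..n}. 0 \<le> s i * (w i \<bullet> (v - c))}
            \<subseteq> cball c' (sqrt ((real n - 1) / real n) * r)"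
proof -
  \<comment> \<open>The diagonal of the orthant chosen by the signs: its coordinates in the basis
    are the \<open>s i\<close>, and its squared norm is \<open>n\<close>.\<close>
  define e where "e = (\<Sum>i\<in>{1..n}. s i *\<^sub>R w i)"
  have on: "w i \<bullet> w j = (if i = j then 1 else 0)" if "i \<in> {1..n}" "j \<in> {1..n}" for i j
    using ob that by (auto simp: orthonormal_basis_def)
  have we: "w i \<bullet> e = s i" if "i \<in> {1..n}" for i
    using that by (simp add: e_def inner_sum_right on if_distrib cong: if_cong)
  have "e \<bullet> e = (\<Sum>i\<in>{1..n}. (s i)\<^sup>2)"
    using orthonormal_basis_Parseval[OF ob, of e] we by (simp add: power2_norm_eq_inner)
  also have "\<dots> = (\<Sum>i\<in>{1..n}. 1)"
    using s by (intro sum.cong) fastforce+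
  finally have ee: "e \<bullet> e = real n" by simp
  have "norm (v - (c + (r / n) *\<^sub>R e)) \<le> sqrt ((real n - 1) / real n) * r"
    if v: "norm (v - c) \<le> r" and sv: "\<And>i. i \<in> {1..n} \<Longrightarrow> 0 \<le> s i * (w i \<bullet> (v - c))" for v
  proof -
    define y where "y = v - c"
    define \<rho> where "\<rho> = norm y"
    have \<rho>: "0 \<le> \<rho>" "\<rho> \<le> r" using v by (auto simp: \<rho>_def y_def)
    have ye: "y \<bullet> e = (\<Sum>i\<in>{1..n}. s i * (w i \<bullet> y))"
      by (simp add: e_def inner_sum_right inner_commute)
    \<comment> \<open>Inside the orthant \<open>y \<bullet> e\<close> is the 1-norm of the
      coordinates of \<open>y\<close>, so it dominates the Euclidean norm
      \<open>\<rho>\<close>.\<close>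
    have "\<rho>\<^sup>2 = (\<Sum>i\<in>{1..n}. (s i * (w i \<bullet> y))\<^sup>2)"
      unfolding \<rho>_def orthonormal_basis_Parseval[OF ob finite_atLeastAtMost]
      using s by (intro sum.cong) (fastforce simp: power_mult_distrib)+
    also have "\<dots> \<le> (y \<bullet> e)\<^sup>2"
      unfolding ye using sv by (intro sum_squares_le_square_sum) (auto simp: y_def)
    finally have "\<rho> \<le> y \<bullet> e"
      by (rule power2_le_imp_le) (unfold ye, use sv in \<open>auto simp: y_def intro!: sum_nonneg\<close>)
    then have *: "r / n * \<rho> \<le> r / n * (y \<bullet> e)"
      using \<open>0 \<le> r\<close> by (intro mult_left_mono) auto
    \<comment> \<open>Here \<open>2 \<le> n\<close> enters. After replacing
      \<open>y \<bullet> e\<close> by \<open>\<rho>\<close>, the squared distance to the new center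
      is at most a quadratic in \<open>\<rho>\<close>; the product below shows that on
      \<open>{0..r}\<close> this quadratic is largest at \<open>\<rho> = r\<close>.\<close>
    have "2 * r / n \<le> r"
      using n \<open>0 \<le> r\<close> by (simp add: field_simps mult_left_mono)
    then have "0 \<le> (r - \<rho>) * (r + \<rho> - 2 * r / n)"
      using \<rho> by (intro mult_nonneg_nonneg) auto
    moreover have "(norm (y - (r / n) *\<^sub>R e))\<^sup>2 = \<rho>\<^sup>2 - 2 * (r / n * (y \<bullet> e)) + r\<^sup>2 / n"
      using n unfolding \<rho>_def power2_norm_eq_inner
      by (simp add: inner_diff_left inner_diff_right ee inner_commute power2_eq_square)
    moreover have "(r - \<rho>) * (r + \<rho> - 2 * r / n) = r\<^sup>2 - \<rho>\<^sup>2 - 2 * (r\<^sup>2 / n) + 2 * (r / n * \<rho>)"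
      using n by (simp add: field_simps power2_eq_square)
    ultimately have "(norm (y - (r / n) *\<^sub>R e))\<^sup>2 \<le> r\<^sup>2 - r\<^sup>2 / n"
      using * by linarith
    also have "\<dots> = (sqrt ((real n - 1) / real n) * r)\<^sup>2"
      using n by (simp add: power_mult_distrib field_simps)
    finally have "norm (y - (r / n) *\<^sub>R e) \<le> sqrt ((real n - 1) / real n) * r"
      by (rule power2_le_imp_le) (use n \<open>0 \<le> r\<close> in auto)
    then show ?thesis by (simp add: y_def algebra_simps)
  qed
  then show ?thesis
    by (intro exI[of _ "c + (r / n) *\<^sub>R e"]) (auto simp: dist_norm norm_minus_commute)
qed

text \<open>The sum of the \<open>v $ j\<close> enters once through \<open>fst D\<close> and once,
  with opposite sign, through the last increment; only
  \<open>snd D + \<gamma> * (a \<bullet> v)\<close> survives. Positivity of \<open>\<gamma>\<close>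
  makes the sign of the utility difference tell the side of the hyperplane.\<close>

lemma separating_query_inner:
  fixes a c :: "real ^ 'n::{finite,linorder}"
  assumes "separating_query x a c LA LB"
  shows "\<exists>\<gamma>>0. \<forall>v. increments v \<bullet> (lottery_vec x LA - lottery_vec x LB) = \<gamma> * (a \<bullet> (v - c))"
proof -
  define D where "D = (lottery_vec x LA - lottery_vec x LB :: (real ^ 'n::{finite,linorder}) \<times> real)"
  obtain \<gamma> where g: "\<gamma> > 0" "snd D = - \<gamma> * (a \<bullet> c)" "\<And>j. fst D $ j = snd D + \<gamma> * a $ j"
    using assms by (auto simp: separating_query_def Let_def D_def)
  have "increments v \<bullet> D = \<gamma> * (a \<bullet> (v - c))" for v
  proof -
    have "v \<bullet> fst D = (\<Sum>j\<in>UNIV. v $ j) * snd D + \<gamma> * (a \<bullet> v)"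
      by (simp add: inner_vec_def g(3) algebra_simps sum.distrib sum_distrib_left sum_distrib_right)
    then have "increments v \<bullet> D = snd D + \<gamma> * (a \<bullet> v)"
      by (simp add: increments_def inner_prod_def algebra_simps)
    then show ?thesis
      by (simp add: g(2) inner_diff_right algebra_simps)
  qed
  with g(1) show ?thesis unfolding D_def by blast
qed

lemma cpm_run_decseq:
  fixes vstar :: "real ^ 'n::{finite,linorder}"
  assumes "cpm_run x vstar P0 P c \<alpha> LA LB" "i \<le> j" "j \<le> CARD('n)"
  shows "P k j \<subseteq> P k i"
  using assms(2,3)
proof (induction j rule: dec_induct)
  case (step j)
  then have "Suc j \<in> {1..CARD('n)}" by simp
  then have "P k (Suc j) \<subseteq> P k (Suc j - 1)"
    using assms(1) unfolding cpm_run_def by blast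
  with step show ?case by auto
qed simp

text \<open>The answer is computed from \<open>vstar\<close> itself: the factor is -1 when the
  utility difference at \<open>vstar\<close> is nonnegative and 1 when it is negative, so every cut
  keeps \<open>vstar\<close>. The induction runs over the queries of one iteration, then over the
  iterations.\<close>

lemma cpm_run_contains_truth:
  fixes vstar :: "real ^ 'n::{finite,linorder}"
  assumes run: "cpm_run x vstar P0 P c \<alpha> LA LB" and "vstar \<in> P0" and "i \<le> CARD('n)"
  shows "vstar \<in> P k i"
proof -
  have step: "vstar \<in> P k j" if "vstar \<in> P k 0" "j \<le> CARD('n)" for k j
    using that(2)
  proof (induction j)
    case (Suc j)
    have "P k (Suc j) = P k j \<inter> {v. answer x vstar (LA k (Suc j)) (LB k (Suc j)) *
        (increments v \<bullet> (lottery_vec x (LA k (Suc j)) - lottery_vec x (LB k (Suc j)))) \<le> 0}"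
      using run Suc.prems unfolding cpm_run_def by auto
    with Suc show ?case
      by (auto simp: answer_def inner_diff_right)
  qed (use that in simp)
  have "vstar \<in> P k 0"
  proof (induction k)
    case 0
    show ?case using run assms(2) by (simp add: cpm_run_def)
  next
    case (Suc k)
    from step[OF this order_refl] show ?case using run by (simp add: cpm_run_def)
  qed
  with step assms(3) show ?thesis by blast
qed

lemma cpm_run_subset_orthant:
  fixes vstar :: "real ^ 'n::{finite,linorder}"
  assumes run: "cpm_run x vstar P0 P c \<alpha> LA LB"
  shows "\<exists>s. (\<forall>i\<in>{1..CARD('n)}. s i \<in> {-1, 1 :: real}) \<and>
    P (Suc k) 0 \<subseteq> {v \<in> P k 0. \<forall>i\<in>{1..CARD('n)}. 0 \<le> s i * (\<alpha> k i \<bullet> (v - c k))}"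
proof (intro exI conjI ballI subsetI CollectI)
  \<comment> \<open>A cut keeps the side on which answer times utility difference is at most 0, so
    the sign is the negated answer.\<close>
  define s where "s i = - answer x vstar (LA k i) (LB k i)" for i
  show "s i \<in> {-1, 1}" for i by (simp add: s_def answer_def)
  fix v assume "v \<in> P (Suc k) 0"
  then have v: "v \<in> P k CARD('n)" using run by (simp add: cpm_run_def)
  then show "v \<in> P k 0" using cpm_run_decseq[OF run] by blast
  fix i assume i: "i \<in> {1..CARD('n)}"
  \<comment> \<open>The sets decrease within an iteration, so the cut made by the
    \<open>i\<close>-th query still holds at its end.\<close>
  have "v \<in> P k i" using v i cpm_run_decseq[OF run, of i "CARD('n)" k] by auto
  then have le: "answer x vstar (LA k i) (LB k i) *
      (increments v \<bullet> (lottery_vec x (LA k i) - lottery_vec x (LB k i))) \<le> 0"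
    using run i unfolding cpm_run_def by blast
  have "separating_query x (\<alpha> k i) (c k) (LA k i) (LB k i)"
    using run i unfolding cpm_run_def by blast
  from separating_query_inner[OF this] obtain \<gamma> where "\<gamma> > 0"
    "increments v \<bullet> (lottery_vec x (LA k i) - lottery_vec x (LB k i)) = \<gamma> * (\<alpha> k i \<bullet> (v - c k))"
    by blast
  with le have "answer x vstar (LA k i) (LB k i) * (\<gamma> * (\<alpha> k i \<bullet> (v - c k))) \<le> 0"
    by simp
  then have "\<gamma> * (s i * (\<alpha> k i \<bullet> (v - c k))) \<ge> 0"
    by (simp add: s_def mult.left_commute)
  with \<open>\<gamma> > 0\<close> show "0 \<le> s i * (\<alpha> k i \<bullet> (v - c k))"
    by (simp add: zero_le_mult_iff)
qed

text \<open>The induction carries the radius of the minimum enclosing ball. The shrunken ball has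
  some center \<open>c'\<close>, in general not \<open>c (Suc k)\<close>; it serves only as a
  competitor, and minimality passes the bound on to the ball around
  \<open>c (Suc k)\<close>.\<close>

lemma cpm_run_radius:
  fixes vstar :: "real ^ 'n::{finite,linorder}"
  assumes run: "cpm_run x vstar P0 P c \<alpha> LA LB" and "2 \<le> CARD('n)"
    and meb: "min_enclosing_ball P0 c0 r0"
  shows "P k 0 \<subseteq> cball (c k) (r0 * sqrt ((real CARD('n) - 1) / real CARD('n)) ^ k)"
proof -
  define q where "q = sqrt ((real CARD('n) - 1) / real CARD('n))"
  have q: "0 \<le> q" using assms(2) by (simp add: q_def)
  have "\<exists>r \<le> r0 * q ^ k. min_enclosing_ball (P k 0) (c k) r"
  proof (induction k)
    case 0
    obtain r where "min_enclosing_ball (P 0 0) (c 0) r" using run unfolding cpm_run_def by blast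
    moreover have "P 0 0 = P0" using run by (simp add: cpm_run_def)
    \<comment> \<open>Uniqueness of centers is not invoked: the ball around \<open>c0\<close>
      competes with the one around \<open>c 0\<close>, which gives
      \<open>r \<le> r0\<close>.\<close>
    ultimately show ?case using meb by (auto simp: min_enclosing_ball_def)
  next
    case (Suc k)
    then obtain r where r: "r \<le> r0 * q ^ k" "0 \<le> r" "P k 0 \<subseteq> cball (c k) r"
      by (auto simp: min_enclosing_ball_def)
    obtain s where s: "\<forall>i\<in>{1..CARD('n)}. s i \<in> {-1, 1 :: real}"
      "P (Suc k) 0 \<subseteq> {v \<in> P k 0. \<forall>i\<in>{1..CARD('n)}. 0 \<le> s i * (\<alpha> k i \<bullet> (v - c k))}"
      using cpm_run_subset_orthant[OF run] by blast
    have "orthonormal_basis {1..CARD('n)} (\<alpha> k)" using run unfolding cpm_run_def by blast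
    from orthant_cball_subset_cball[OF this assms(2) r(2), of s "c k"] s(1)
    obtain c' where "{v \<in> cball (c k) r. \<forall>i\<in>{1..CARD('n)}. 0 \<le> s i * (\<alpha> k i \<bullet> (v - c k))}
       \<subseteq> cball c' (q * r)"
      unfolding q_def by blast
    then have "P (Suc k) 0 \<subseteq> cball c' (q * r)" using s(2) r(3) by fastforce
    moreover obtain r' where r': "min_enclosing_ball (P (Suc k) 0) (c (Suc k)) r'"
      using run unfolding cpm_run_def by blast
    ultimately have "r' \<le> q * r" using q r(2) by (auto simp: min_enclosing_ball_def)
    also have "\<dots> \<le> r0 * q ^ Suc k"
      using mult_left_mono[OF r(1) q] by (simp add: algebra_simps)
    finally show ?case using r' by blast
  qed
  then show ?thesis by (force simp: min_enclosing_ball_def q_def)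
qed

subsection \<open>Piecewise-linear utilities\<close>

text \<open>A clamped linear function on the whole line replaces the case distinction over
  breakpoint intervals, so that bounds and continuity are immediate.\<close>

definition ramp :: "real \<Rightarrow> real \<Rightarrow> real \<Rightarrow> real" where
  "ramp p q t = max 0 (min 1 ((t - p) / (q - p)))"

lemma ramp_bounds: "0 \<le> ramp p q t" "ramp p q t \<le> 1"
  by (auto simp: ramp_def)

lemma ramp_eq_0: "p < q \<Longrightarrow> t \<le> p \<Longrightarrow> ramp p q t = 0"
  by (simp add: ramp_def field_simps min_def max_def)

lemma ramp_eq_1: "p < q \<Longrightarrow> q \<le> t \<Longrightarrow> ramp p q t = 1"
  by (simp add: ramp_def field_simps min_def max_def)

lemma ramp_between: "p < q \<Longrightarrow> p \<le> t \<Longrightarrow> t \<le> q \<Longrightarrow> ramp p q t = (t - p) / (q - p)"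
  by (simp add: ramp_def field_simps min_def max_def)

text \<open>The fundamental theorem of calculus, with the kinks \<open>p\<close> and
  \<open>q\<close> as the finitely many exceptional points.\<close>

lemma ramp_density_has_integral:
  assumes "p < q" "c \<le> d"
  shows "((\<lambda>t. if t \<in> {p..q} then 1 / (q - p) else 0) has_integral (ramp p q d - ramp p q c)) {c..d}"
proof (rule fundamental_theorem_of_calculus_interior_strong[of "{p, q}"])
  show "continuous_on {c..d} (ramp p q)"
    unfolding ramp_def using assms by (intro continuous_intros) auto
  fix t assume t: "t \<in> {c<..<d} - {p, q}"
  consider "t < p" | "p < t" "t < q" | "q < t" using t by fastforce
  then show "(ramp p q has_vector_derivative (if t \<in> {p..q} then 1 / (q - p) else 0)) (at t)"
  proof cases
    case 1
    have "((\<lambda>t. 0) has_vector_derivative 0) (at t)" by (auto intro: derivative_intros)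
    then have "(ramp p q has_vector_derivative 0) (at t)"
      by (rule has_vector_derivative_transform_within_open[of _ _ _ "{..<p}"])
        (use 1 assms ramp_eq_0 in auto)
    with 1 show ?thesis by auto
  next
    case 2
    have "((\<lambda>t. (t - p) / (q - p)) has_vector_derivative 1 / (q - p)) (at t)"
      using assms by (auto simp: has_real_derivative_iff_has_vector_derivative[symmetric] intro!: derivative_eq_intros)
    then have "(ramp p q has_vector_derivative 1 / (q - p)) (at t)"
      by (rule has_vector_derivative_transform_within_open[of _ _ _ "{p<..<q}"])
        (use 2 assms ramp_between in auto)
    with 2 show ?thesis by auto
  next
    case 3
    have "((\<lambda>t. 1) has_vector_derivative 0) (at t)" by (auto intro: derivative_intros)
    then have "(ramp p q has_vector_derivative 0) (at t)"
      by (rule has_vector_derivative_transform_within_open[of _ _ _ "{q<..}"])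
        (use 3 assms ramp_eq_1 in auto)
    with 3 show ?thesis by auto
  qed
qed (use assms in auto)

lemma ex_breakpoint_interval:
  fixes x :: "nat \<Rightarrow> real"
  assumes "x 1 < t" "t \<le> x (N + 1)"
  shows "\<exists>i\<in>{1..N}. t \<in> {x i <.. x (i + 1)}"
  using assms
proof (induction N)
  case (Suc N)
  show ?case
  proof (cases "t \<le> x (N + 1)")
    case True
    with Suc show ?thesis by force
  next
    case False
    with Suc.prems show ?thesis by (intro bexI[of _ "Suc N"]) auto
  qed
qed simp

text \<open>The half-open intervals between breakpoints are disjoint and cover every
  \<open>t\<close> other than \<open>x 1\<close>, which determines the definite description; whether
  \<open>j\<close> lies below, at or above that index decides the branch of the ramp.\<close>

lemma basis_coord_eq_ramp:
  assumes sm: "strict_mono_on {1..N + 1} x" and t: "t \<in> {x 1..x (N + 1)}" and j: "j \<in> {1..N}"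
  shows "basis_coord N x t j = ramp (x j) (x (j + 1)) t"
proof -
  have mono: "x i \<le> x k" if "1 \<le> i" "i \<le> k" "k \<le> N + 1" for i k
    using strict_mono_on_leD[OF sm] that by auto
  have lt: "x j < x (j + 1)" using sm j by (auto simp: strict_mono_on_def)
  show ?thesis
  proof (cases "t = x 1")
    case True
    with mono[of 1 j] j ramp_eq_0[OF lt, of "x 1"] show ?thesis by (simp add: basis_coord_def)
  next
    case False
    with t obtain i where i: "i \<in> {1..N}" "t \<in> {x i <.. x (i + 1)}"
      using ex_breakpoint_interval[of x t N] by auto
    have un: "k = i" if "k \<in> {1..N}" "t \<in> {x k <.. x (k + 1)}" for k
    proof (rule ccontr)
      assume "k \<noteq> i"
      then consider "k + 1 \<le> i" | "i + 1 \<le> k" by linarith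
      then show False
        using that i mono[of "k + 1" i] mono[of "i + 1" k] by cases auto
    qed
    have the_i: "(THE i. i \<in> {1..N} \<and> t \<in> {x i <.. x (i + 1)}) = i"
      using i un by (intro the_equality conjI) blast+
    have bc: "basis_coord N x t j =
        (if j < i then 1 else if j = i then (t - x i) / (x (i + 1) - x i) else 0)"
      using False by (simp only: basis_coord_def the_i Let_def if_False)
    consider "j < i" | "j = i" | "i < j" by linarith
    then show ?thesis
    proof cases
      case 1
      with i j mono[of "j + 1" i] have "x (j + 1) \<le> t" by auto
      with 1 show ?thesis
        unfolding bc using ramp_eq_1[OF lt, of t] by simp
    next
      case 2
      with i have "x j \<le> t" "t \<le> x (j + 1)" by auto
      with 2 show ?thesis
        unfolding bc using ramp_between[OF lt, of t] by simp
    next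
      case 3
      with i j mono[of "i + 1" j] have "t \<le> x j" by auto
      with 3 show ?thesis
        unfolding bc using ramp_eq_0[OF lt, of t] by simp
    qed
  qed
qed

lemma pos_in_range: "pos (j :: 'n::{finite,linorder}) \<in> {1..CARD('n)}"
proof -
  have "card {j} \<le> card {i. i \<le> j}" by (intro card_mono) auto
  moreover have "card {i. i \<le> j} \<le> CARD('n)" by (intro card_mono) auto
  ultimately show ?thesis by (simp add: pos_def)
qed

abbreviation step_ramp :: "(nat \<Rightarrow> real) \<Rightarrow> nat \<Rightarrow> real \<Rightarrow> real" where
  "step_ramp x j \<equiv> ramp (x j) (x (j + 1))"

text \<open>Writes the utility as a linear combination of fixed functions, the form from which
  endpoint values, differences and densities are read off.\<close>

lemma pl_utility_eq_ramps:
  fixes v :: "real ^ 'n::{finite,linorder}"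
  assumes "strict_mono_on {1..CARD('n) + 2} x" "t \<in> {x 1..x (CARD('n) + 2)}"
  shows "pl_utility x v t = (\<Sum>j\<in>UNIV. v $ j * step_ramp x (pos j) t) +
     (1 - (\<Sum>j\<in>UNIV. v $ j)) * step_ramp x (CARD('n) + 1) t"
proof -
  have "basis_coord (CARD('n) + 1) x t j = step_ramp x j t" if "j \<in> {1..CARD('n) + 1}" for j
    using assms that by (intro basis_coord_eq_ramp) auto
  moreover have "pos j \<in> {1..CARD('n) + 1}" for j :: 'n using pos_in_range[of j] by auto
  ultimately show ?thesis
    by (simp add: pl_utility_def increments_def basis_map_def inner_prod_def inner_vec_def)
qed

text \<open>At the left end all ramps are 0; at the right end all are 1, and the increments add up
  to 1.\<close>

lemma pl_utility_endpoints:
  fixes v :: "real ^ 'n::{finite,linorder}"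
  assumes "strict_mono_on {1..CARD('n) + 2} x"
  shows "pl_utility x v (x 1) = 0" "pl_utility x v (x (CARD('n) + 2)) = 1"
proof -
  let ?I = "{1..CARD('n) + 1}"
  have le: "x i \<le> x k" if "1 \<le> i" "i \<le> k" "k \<le> CARD('n) + 2" for i k
    using strict_mono_on_leD[OF assms] that by auto
  have lt: "x j < x (j + 1)" if "j \<in> ?I" for j
    using assms that by (auto simp: strict_mono_on_def)
  have "step_ramp x j (x 1) = 0" "step_ramp x j (x (CARD('n) + 2)) = 1" if "j \<in> ?I" for j
    using that le lt[OF that] by (auto intro!: ramp_eq_0 ramp_eq_1)
  moreover have "pos j \<in> ?I" for j :: 'n using pos_in_range[of j] by auto
  moreover have "x 1 \<in> {x 1..x (CARD('n) + 2)}" "x (CARD('n) + 2) \<in> {x 1..x (CARD('n) + 2)}"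
    using le by auto
  ultimately show "pl_utility x v (x 1) = 0" "pl_utility x v (x (CARD('n) + 2)) = 1"
    by (simp_all add: pl_utility_eq_ramps[OF assms])
qed

text \<open>Cauchy-Schwarz against the all-ones vector.\<close>

lemma norm1_le_sqrt_card_norm:
  fixes d :: "real ^ 'n::finite"
  shows "(\<Sum>j\<in>UNIV. \<bar>d $ j\<bar>) \<le> sqrt (real CARD('n)) * norm d"
  using L2_set_mult_ineq[of "\<lambda>_. 1" "\<lambda>j. d $ j" UNIV]
  by (simp add: norm_vec_def L2_set_def)

text \<open>The last increment is one minus the others. Eliminating it multiplies each coordinate of
  \<open>v - w\<close> by a difference of two ramps, a number in \<open>{-1..1}\<close>, so the last
  coordinate costs no extra term.\<close>

lemma pl_utility_diff_le:
  fixes v w :: "real ^ 'n::{finite,linorder}"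
  assumes "strict_mono_on {1..CARD('n) + 2} x" "t \<in> {x 1..x (CARD('n) + 2)}"
  shows "\<bar>pl_utility x v t - pl_utility x w t\<bar> \<le> sqrt (real CARD('n)) * norm (v - w)"
proof -
  let ?D = "\<lambda>j. step_ramp x (pos j) t - step_ramp x (CARD('n) + 1) t"
  have "pl_utility x v t - pl_utility x w t = (\<Sum>j\<in>UNIV. (v - w) $ j * ?D j)"
    unfolding pl_utility_eq_ramps[OF assms]
    by (simp add: left_diff_distrib right_diff_distrib sum_subtractf sum_distrib_right[symmetric])
  also have "\<bar>\<dots>\<bar> \<le> (\<Sum>j\<in>UNIV. \<bar>(v - w) $ j\<bar>)"
  proof (intro order_trans[OF sum_abs] sum_mono)
    fix j :: 'n
    have "\<bar>?D j\<bar> \<le> 1"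
      using ramp_bounds[of "x (pos j)" "x (pos j + 1)" t]
        ramp_bounds[of "x (CARD('n) + 1)" "x (CARD('n) + 1 + 1)" t] by linarith
    then show "\<bar>(v - w) $ j * ?D j\<bar> \<le> \<bar>(v - w) $ j\<bar>"
      by (simp add: abs_mult mult_left_le)
  qed
  also have "\<dots> \<le> sqrt (real CARD('n)) * norm (v - w)"
    by (rule norm1_le_sqrt_card_norm)
  finally show ?thesis .
qed

subsection \<open>Stieltjes integrals against functions with a bounded density\<close>

text \<open>Integrability of products with continuous functions is a clause of its own, so that it
  passes to linear combinations together with the other two. The density may change sign, as may the
  increments.\<close>

definition has_bounded_density :: "real \<Rightarrow> real \<Rightarrow> (real \<Rightarrow> real) \<Rightarrow> (real \<Rightarrow> real) \<Rightarrow> bool" where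
  "has_bounded_density a b u \<phi> \<longleftrightarrow>
     (\<forall>c d. a \<le> c \<and> c \<le> d \<and> d \<le> b \<longrightarrow> (\<phi> has_integral (u d - u c)) {c..d}) \<and>
     (\<exists>M. \<forall>t\<in>{a..b}. \<bar>\<phi> t\<bar> \<le> M) \<and>
     (\<forall>f. continuous_on {a..b} f \<longrightarrow> (\<lambda>t. f t * \<phi> t) integrable_on {a..b})"

lemma has_bounded_density_add:
  assumes "has_bounded_density a b u \<phi>" "has_bounded_density a b v \<psi>"
  shows "has_bounded_density a b (\<lambda>t. u t + v t) (\<lambda>t. \<phi> t + \<psi> t)"
  unfolding has_bounded_density_def
proof (intro conjI allI impI)
  fix c d assume "a \<le> c \<and> c \<le> d \<and> d \<le> b"
  then have "((\<lambda>t. \<phi> t + \<psi> t) has_integral ((u d - u c) + (v d - v c))) {c..d}"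
    using assms unfolding has_bounded_density_def by (intro has_integral_add) auto
  then show "((\<lambda>t. \<phi> t + \<psi> t) has_integral (u d + v d - (u c + v c))) {c..d}"
    by (simp add: algebra_simps)
next
  obtain M M' where "\<forall>t\<in>{a..b}. \<bar>\<phi> t\<bar> \<le> M" "\<forall>t\<in>{a..b}. \<bar>\<psi> t\<bar> \<le> M'"
    using assms unfolding has_bounded_density_def by blast
  then show "\<exists>M. \<forall>t\<in>{a..b}. \<bar>\<phi> t + \<psi> t\<bar> \<le> M"
    by (intro exI[of _ "M + M'"]) (smt (verit))
next
  fix f :: "real \<Rightarrow> real" assume "continuous_on {a..b} f"
  then show "(\<lambda>t. f t * (\<phi> t + \<psi> t)) integrable_on {a..b}"
    using assms unfolding has_bounded_density_def
    by (simp add: distrib_left integrable_add)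
qed

lemma has_bounded_density_cmult:
  assumes "has_bounded_density a b u \<phi>"
  shows "has_bounded_density a b (\<lambda>t. k * u t) (\<lambda>t. k * \<phi> t)"
  unfolding has_bounded_density_def
proof (intro conjI allI impI)
  fix c d assume "a \<le> c \<and> c \<le> d \<and> d \<le> b"
  then have "((\<lambda>t. k * \<phi> t) has_integral (k * (u d - u c))) {c..d}"
    using assms unfolding has_bounded_density_def by (intro has_integral_mult_right) auto
  then show "((\<lambda>t. k * \<phi> t) has_integral (k * u d - k * u c)) {c..d}"
    by (simp add: algebra_simps)
next
  obtain M where "\<forall>t\<in>{a..b}. \<bar>\<phi> t\<bar> \<le> M"
    using assms unfolding has_bounded_density_def by blast
  then show "\<exists>M. \<forall>t\<in>{a..b}. \<bar>k * \<phi> t\<bar> \<le> M"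
    by (intro exI[of _ "\<bar>k\<bar> * M"]) (auto simp: abs_mult intro!: mult_left_mono)
next
  fix f :: "real \<Rightarrow> real" assume "continuous_on {a..b} f"
  then have "(\<lambda>t. k * (f t * \<phi> t)) integrable_on {a..b}"
    using assms unfolding has_bounded_density_def by (intro integrable_on_mult_right) auto
  then show "(\<lambda>t. f t * (k * \<phi> t)) integrable_on {a..b}"
    by (simp add: algebra_simps)
qed

lemma has_bounded_density_sum:
  assumes "finite I" "\<And>i. i \<in> I \<Longrightarrow> has_bounded_density a b (u i) (\<phi> i)"
  shows "has_bounded_density a b (\<lambda>t. \<Sum>i\<in>I. u i t) (\<lambda>t. \<Sum>i\<in>I. \<phi> i t)"
  using assms
proof (induction I rule: finite_induct)
  case empty
  show ?case by (auto simp: has_bounded_density_def)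
next
  case (insert i I)
  then show ?case by (simp add: has_bounded_density_add)
qed

lemma has_bounded_density_cong:
  assumes "has_bounded_density a b u \<phi>" "\<And>t. t \<in> {a..b} \<Longrightarrow> u t = v t"
  shows "has_bounded_density a b v \<phi>"
  using assms by (force simp: has_bounded_density_def)

text \<open>On \<open>{p..q}\<close> the density is constant, so its product with a continuous
  function is integrable there and extends by zero.\<close>

lemma has_bounded_density_ramp:
  assumes "p < q" "a \<le> p" "q \<le> b"
  shows "has_bounded_density a b (ramp p q) (\<lambda>t. if t \<in> {p..q} then 1 / (q - p) else 0)"
  unfolding has_bounded_density_def
proof (intro conjI allI impI)
  show "\<exists>M. \<forall>t\<in>{a..b}. \<bar>if t \<in> {p..q} then 1 / (q - p) else 0\<bar> \<le> M"
    using assms by (intro exI[of _ "1 / (q - p)"]) auto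
  fix f :: "real \<Rightarrow> real" assume "continuous_on {a..b} f"
  then have "(\<lambda>t. f t * (1 / (q - p))) integrable_on {p..q}"
    using assms by (intro integrable_continuous_real continuous_intros)
      (auto intro: continuous_on_subset)
  moreover have "{p..q} \<inter> {a..b} = {p..q}" using assms by auto
  ultimately have "(\<lambda>t. if t \<in> {p..q} then f t * (1 / (q - p)) else 0) integrable_on {a..b}"
    by (subst integrable_restrict_Int) (simp only:)
  then show "(\<lambda>t. f t * (if t \<in> {p..q} then 1 / (q - p) else 0)) integrable_on {a..b}"
    by (rule integrable_eq) auto
qed (use assms ramp_density_has_integral in auto)

lemma pl_utility_has_bounded_density:
  fixes v :: "real ^ 'n::{finite,linorder}"
  assumes "strict_mono_on {1..CARD('n) + 2} x"
  shows "\<exists>\<phi>. has_bounded_density (x 1) (x (CARD('n) + 2)) (pl_utility x v) \<phi>"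
proof -
  \<comment> \<open>The closed intervals overlap at breakpoints, where two densities add up; these
    finitely many points do not affect integrals.\<close>
  let ?\<rho> = "\<lambda>j t. if t \<in> {x j..x (j + 1)} then 1 / (x (j + 1) - x j) else 0"
  have ramp: "has_bounded_density (x 1) (x (CARD('n) + 2)) (step_ramp x j) (?\<rho> j)"
    if "j \<in> {1..CARD('n) + 1}" for j
  proof (rule has_bounded_density_ramp)
    show "x j < x (j + 1)" using assms that by (auto simp: strict_mono_on_def)
    show "x 1 \<le> x j" "x (j + 1) \<le> x (CARD('n) + 2)"
      using strict_mono_on_leD[OF assms] that by auto
  qed
  have pos: "pos j \<in> {1..CARD('n) + 1}" for j :: 'n using pos_in_range[of j] by auto
  have "has_bounded_density (x 1) (x (CARD('n) + 2))
     (\<lambda>t. (\<Sum>j\<in>UNIV. v $ j * step_ramp x (pos j) t) +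
        (1 - (\<Sum>j\<in>UNIV. v $ j)) * step_ramp x (CARD('n) + 1) t)
     (\<lambda>t. (\<Sum>j\<in>UNIV. v $ j * ?\<rho> (pos j) t) +
        (1 - (\<Sum>j\<in>UNIV. v $ j)) * ?\<rho> (CARD('n) + 1) t)"
    by (intro has_bounded_density_add has_bounded_density_sum has_bounded_density_cmult ramp pos)
      auto
  from has_bounded_density_cong[OF this, of "pl_utility x v"] show ?thesis
    using pl_utility_eq_ramps[OF assms, of _ v] by auto
qed

lemma has_bounded_density_integrable_sub:
  assumes "has_bounded_density a b u \<phi>" "continuous_on {a..b} f" "{c..d} \<subseteq> {a..b}"
  shows "(\<lambda>t. f t * \<phi> t) integrable_on {c..d}"
  using assms unfolding has_bounded_density_def
  by (auto intro: integrable_on_subinterval)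

text \<open>The increment of \<open>u\<close> is the integral of \<open>\<phi>\<close>, so the error
  is the integral of \<open>(f t - f \<tau>) * \<phi> t\<close>, whose integrand is at most
  \<open>h * M\<close> by the Lipschitz condition.\<close>

lemma has_bounded_density_local_error:
  assumes u: "has_bounded_density a b u \<phi>" and f: "1-lipschitz_on {a..b} f"
    and M: "\<And>t. t \<in> {a..b} \<Longrightarrow> \<bar>\<phi> t\<bar> \<le> M"
    and cd: "a \<le> c" "c \<le> d" "d \<le> b" and \<tau>: "\<tau> \<in> {a..b}"
    and h: "\<And>t. t \<in> {c..d} \<Longrightarrow> \<bar>t - \<tau>\<bar> \<le> h"
  shows "\<bar>integral {c..d} (\<lambda>t. f t * \<phi> t) - f \<tau> * (u d - u c)\<bar> \<le> h * M * (d - c)"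
proof -
  have cont: "continuous_on {a..b} f" using f by (rule lipschitz_on_continuous_on)
  have "((\<lambda>t. f t * \<phi> t) has_integral integral {c..d} (\<lambda>t. f t * \<phi> t)) {c..d}"
    using has_bounded_density_integrable_sub[OF u cont, of c d] cd by (auto simp: has_integral_integral)
  moreover have "((\<lambda>t. f \<tau> * \<phi> t) has_integral f \<tau> * (u d - u c)) {c..d}"
    using u cd unfolding has_bounded_density_def by (intro has_integral_mult_right) auto
  ultimately have "((\<lambda>t. f t * \<phi> t - f \<tau> * \<phi> t) has_integral
      integral {c..d} (\<lambda>t. f t * \<phi> t) - f \<tau> * (u d - u c)) (cbox c d)"
    by (simp add: has_integral_diff)
  moreover have "norm (f t * \<phi> t - f \<tau> * \<phi> t) \<le> h * M" if "t \<in> cbox c d" for t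
  proof -
    have t: "t \<in> {a..b}" using that cd by auto
    have "\<bar>f t - f \<tau>\<bar> \<le> \<bar>t - \<tau>\<bar>"
      using lipschitz_onD[OF f t \<tau>] by (simp add: dist_real_def)
    also have "\<dots> \<le> h" using h that by auto
    finally have "\<bar>f t - f \<tau>\<bar> * \<bar>\<phi> t\<bar> \<le> h * M"
      using M[OF t] by (intro mult_mono) auto
    then show ?thesis by (simp add: left_diff_distrib[symmetric] abs_mult)
  qed
  moreover have "0 \<le> h * M"
    using M[OF \<tau>] h[of c] cd by (intro mult_nonneg_nonneg) auto
  ultimately have "norm (integral {c..d} (\<lambda>t. f t * \<phi> t) - f \<tau> * (u d - u c))
      \<le> h * M * measure lborel (cbox c d)"
    by (rule has_integral_bound[rotated])
  with cd show ?thesis by simp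
qed

text \<open>The integral splits over the pieces of a tagged division, and the local errors add up to
  at most \<open>h * M * (b - a)\<close>.\<close>

lemma has_stieltjes_integral_density:
  assumes u: "has_bounded_density a b u \<phi>" and f: "1-lipschitz_on {a..b} f" and "a \<le> b"
  shows "has_stieltjes_integral f u a b (integral {a..b} (\<lambda>t. f t * \<phi> t))"
  unfolding has_stieltjes_integral_def
proof (intro allI impI)
  fix e :: real assume "e > 0"
  obtain M0 where M0: "\<forall>t\<in>{a..b}. \<bar>\<phi> t\<bar> \<le> M0"
    using u unfolding has_bounded_density_def by blast
  \<comment> \<open>Raising the bound to at least 1 keeps the denominator of \<open>h\<close>
    positive; the summand 1 in \<open>b - a + 1\<close> does so when \<open>a = b\<close>.\<close>
  define M where "M = max M0 1"
  define h where "h = e / (2 * M * (b - a + 1))"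
  have M: "\<bar>\<phi> t\<bar> \<le> M" if "t \<in> {a..b}" for t using M0 that by (force simp: M_def)
  have "M \<ge> 1" by (simp add: M_def)
  have "h > 0" using \<open>e > 0\<close> \<open>M \<ge> 1\<close> \<open>a \<le> b\<close> by (simp add: h_def)
  have cont: "continuous_on {a..b} f" using f by (rule lipschitz_on_continuous_on)
  let ?F = "\<lambda>t. f t * \<phi> t"
  have "\<bar>(\<Sum>(t, K)\<in>p. f t * (u (Sup K) - u (Inf K))) - integral {a..b} ?F\<bar> < e"
    if p: "p tagged_division_of {a..b}" "(\<lambda>t. ball t h) fine p" for p
  proof -
    have "integral {a..b} ?F = (\<Sum>(t, K)\<in>p. integral K ?F)"
      using has_bounded_density_integrable_sub[OF u cont subset_refl] p(1)
      by (simp add: integral_combine_tagged_division_topdown[of ?F a b p, unfolded interval_cbox[symmetric]])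
    then have "\<bar>(\<Sum>(t, K)\<in>p. f t * (u (Sup K) - u (Inf K))) - integral {a..b} ?F\<bar>
      = \<bar>\<Sum>(t, K)\<in>p. integral K ?F - f t * (u (Sup K) - u (Inf K))\<bar>"
      by (simp add: sum_subtractf case_prod_unfold abs_minus_commute)
    also have "\<dots> \<le> (\<Sum>(t, K)\<in>p. h * M * measure lborel K)"
      unfolding case_prod_unfold
    proof (intro order_trans[OF sum_abs] sum_mono)
      fix z assume z: "z \<in> p"
      obtain t K where tK: "z = (t, K)" by force
      obtain c d where K: "K = {c..d}" using tagged_division_ofD(4)[OF p(1), of t K] z tK
        by (auto simp: cbox_interval)
      have *: "t \<in> K" "K \<subseteq> {a..b}" "K \<subseteq> ball t h"
        using tagged_division_ofD(2,3)[OF p(1), of t K] fineD[OF p(2), of t K] z tK by auto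
      have "c \<le> d" using * K by auto
      moreover from this have "a \<le> c" "d \<le> b" using * K by auto
      moreover have "\<bar>s - t\<bar> \<le> h" if "s \<in> {c..d}" for s
        using * K that by (force simp: dist_real_def subset_iff)
      ultimately have "\<bar>integral {c..d} ?F - f t * (u d - u c)\<bar> \<le> h * M * (d - c)"
        using * by (intro has_bounded_density_local_error[OF u f M]) auto
      then show "\<bar>integral (snd z) ?F - f (fst z) * (u (Sup (snd z)) - u (Inf (snd z)))\<bar>
        \<le> h * M * measure lborel (snd z)"
        using \<open>c \<le> d\<close> by (simp add: tK K)
    qed
    also have "\<dots> = h * M * (b - a)"
      using additive_content_tagged_division[of p a b] p(1) \<open>a \<le> b\<close>
      by (simp add: case_prod_unfold sum_distrib_left[symmetric])
    also have "\<dots> < e"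
    proof -
      have "h * M = e / (2 * (b - a + 1))"
        using \<open>M \<ge> 1\<close> by (simp add: h_def)
      then have "h * M * (b - a) = e * ((b - a) / (2 * (b - a + 1)))"
        by simp
      also have "\<dots> < e * 1"
        using \<open>e > 0\<close> \<open>a \<le> b\<close> by (intro mult_strict_left_mono) (auto simp: field_simps)
      finally show ?thesis by simp
    qed
    finally show ?thesis .
  qed
  with \<open>h > 0\<close> show "\<exists>h>0. \<forall>p. p tagged_division_of {a..b} \<and> (\<lambda>t. ball t h) fine p \<longrightarrow>
       \<bar>(\<Sum>(t, K)\<in>p. f t * (u (Sup K) - u (Inf K))) - integral {a..b} ?F\<bar> < e"
    by blast
qed

text \<open>Two candidate values are compared on a single tagged division fine for both meshes. That
  such a division exists (Cousin's lemma) keeps the defining condition from being vacuous.\<close>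

lemma has_stieltjes_integral_unique:
  assumes "has_stieltjes_integral f u a b I" "has_stieltjes_integral f u a b J"
  shows "I = J"
proof (rule ccontr)
  assume "I \<noteq> J"
  define e where "e = \<bar>I - J\<bar> / 2"
  have "e > 0" using \<open>I \<noteq> J\<close> by (simp add: e_def)
  let ?S = "\<lambda>p. \<Sum>(t, K)\<in>p. f t * (u (Sup K) - u (Inf K))"
  obtain h where h: "h > 0"
    "\<forall>p. p tagged_division_of {a..b} \<and> (\<lambda>t. ball t h) fine p \<longrightarrow> \<bar>?S p - I\<bar> < e"
    using assms(1)[unfolded has_stieltjes_integral_def, rule_format, OF \<open>e > 0\<close>] by (elim exE conjE)
  obtain h' where h': "h' > 0"
    "\<forall>p. p tagged_division_of {a..b} \<and> (\<lambda>t. ball t h') fine p \<longrightarrow> \<bar>?S p - J\<bar> < e"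
    using assms(2)[unfolded has_stieltjes_integral_def, rule_format, OF \<open>e > 0\<close>] by (elim exE conjE)
  obtain p where p: "p tagged_division_of {a..b}" "(\<lambda>t. ball t (min h h')) fine p"
  proof (rule fine_division_exists_real)
    show "gauge (\<lambda>t. ball t (min h h'))" using h(1) h'(1) by (intro gauge_ball) simp
  qed
  have "(\<lambda>t. ball t h) fine p" "(\<lambda>t. ball t h') fine p"
    using p(2) unfolding fine_def by fastforce+
  with p(1) have "\<bar>?S p - I\<bar> < e" "\<bar>?S p - J\<bar> < e"
    using h(2)[rule_format, of p] h'(2)[rule_format, of p] by auto
  then have "\<bar>I - J\<bar> < e + e"
    using abs_triangle_ineq4[of "?S p - J" "?S p - I"] by simp
  then show False by (simp add: e_def)
qed

lemma stieltjes_integral_density: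
  assumes "has_bounded_density a b u \<phi>" "1-lipschitz_on {a..b} f" "a \<le> b"
  shows "stieltjes_integral a b f u = integral {a..b} (\<lambda>t. f t * \<phi> t)"
  unfolding stieltjes_integral_def
  using has_stieltjes_integral_density[OF assms]
  by (intro the_equality has_stieltjes_integral_unique)

text \<open>
  Integration by parts, carried out on \<open>m\<close> equal pieces with an error term that vanishes as
  \<open>m\<close> grows.
\<close>

lemma density_integral_le_sup_norm:
  assumes w: "has_bounded_density a b w \<phi>" and f: "1-lipschitz_on {a..b} f" and "a \<le> b"
    and S: "\<And>t. t \<in> {a..b} \<Longrightarrow> \<bar>w t\<bar> \<le> S" and "w a = 0" "w b = 0"
  shows "\<bar>integral {a..b} (\<lambda>t. f t * \<phi> t)\<bar> \<le> (b - a) * S"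
proof -
  let ?F = "\<lambda>t. f t * \<phi> t"
  obtain M where M: "\<And>t. t \<in> {a..b} \<Longrightarrow> \<bar>\<phi> t\<bar> \<le> M"
    using w unfolding has_bounded_density_def by blast
  have cont: "continuous_on {a..b} f" using f by (rule lipschitz_on_continuous_on)
  \<comment> \<open>The increment of the product \<open>f * w\<close> is
    \<open>f c * (w d - w c) + (f d - f c) * w d\<close>. The first term approximates the integral
    up to an error quadratic in \<open>d - c\<close>; the second is bounded by the Lipschitz
    condition and \<open>S\<close>.\<close>
  have local: "\<bar>integral {c..d} ?F - (f d * w d - f c * w c)\<bar> \<le> (d - c) * M * (d - c) + (d - c) * S"
    if "a \<le> c" "c \<le> d" "d \<le> b" for c d
  proof -
    have "\<bar>integral {c..d} ?F - f c * (w d - w c)\<bar> \<le> (d - c) * M * (d - c)"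
      using that by (intro has_bounded_density_local_error[OF w f M]) auto
    moreover have "\<bar>(f d - f c) * w d\<bar> \<le> (d - c) * S"
      using lipschitz_onD[OF f, of d c] S[of d] that
      by (auto simp: abs_mult dist_real_def intro!: mult_mono)
    ultimately show ?thesis by (simp add: algebra_simps)
  qed
  \<comment> \<open>The increments of \<open>f * w\<close> telescope over \<open>m\<close> adjacent
    pieces of length \<open>h\<close>.\<close>
  have pieces: "\<bar>integral {a..a + real m * h} ?F - (f (a + real m * h) * w (a + real m * h) - f a * w a)\<bar>
      \<le> real m * (h * M * h + h * S)"
    if "0 \<le> h" "a + real m * h \<le> b" for m h
    using that(2)
  proof (induction m)
    case (Suc m)
    let ?c = "a + real m * h" and ?d = "a + real (Suc m) * h"
    have cd: "a \<le> ?c" "?c \<le> ?d" "?d - ?c = h" using that(1) by (auto simp: algebra_simps)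
    have "integral {a..?c} ?F + integral {?c..?d} ?F = integral {a..?d} ?F"
      using cd Suc.prems
      by (intro Henstock_Kurzweil_Integration.integral_combine
          has_bounded_density_integrable_sub[OF w cont]) auto
    moreover have "\<bar>integral {?c..?d} ?F - (f ?d * w ?d - f ?c * w ?c)\<bar> \<le> h * M * h + h * S"
      using local[of ?c ?d] cd Suc.prems by simp
    moreover have "\<bar>integral {a..?c} ?F - (f ?c * w ?c - f a * w a)\<bar> \<le> real m * (h * M * h + h * S)"
      using Suc cd by auto
    moreover have "real (Suc m) * (h * M * h + h * S) = real m * (h * M * h + h * S) + (h * M * h + h * S)"
      by (simp add: algebra_simps)
    ultimately show ?case by linarith
  qed simp
  \<comment> \<open>With \<open>Suc m\<close> pieces the boundary terms vanish, since
    \<open>w\<close> is zero at both ends, and the quadratic errors add up to a multiple of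
    \<open>1 / Suc m\<close>.\<close>
  let ?g = "\<lambda>m. (b - a)\<^sup>2 * M * inverse (real (Suc m)) + (b - a) * S"
  have "\<bar>integral {a..b} ?F\<bar> \<le> ?g m" for m
  proof -
    let ?h = "(b - a) / real (Suc m)"
    have end_: "a + real (Suc m) * ?h = b" by simp
    have "\<bar>integral {a..b} ?F\<bar> \<le> real (Suc m) * (?h * M * ?h + ?h * S)"
      using pieces[of ?h "Suc m"] \<open>a \<le> b\<close> \<open>w a = 0\<close> \<open>w b = 0\<close> unfolding end_ by simp
    also have "\<dots> = ?g m"
      by (simp add: field_simps power2_eq_square del: of_nat_Suc)
    finally show ?thesis .
  qed
  moreover have "?g \<longlonglongrightarrow> (b - a)\<^sup>2 * M * 0 + (b - a) * S"
    by (intro tendsto_intros LIMSEQ_inverse_real_of_nat)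
  ultimately have "\<bar>integral {a..b} ?F\<bar> \<le> (b - a)\<^sup>2 * M * 0 + (b - a) * S"
    by (intro LIMSEQ_le_const) auto
  then show ?thesis by simp
qed

text \<open>Both Stieltjes integrals are integrals against densities. Their difference integrates
  \<open>f\<close> against the density of \<open>u - v\<close>, which vanishes at both ends, so the
  integration by parts bound applies to each test function.\<close>

lemma dist_K_le_dist_I:
  assumes u: "has_bounded_density a b u \<phi>" and v: "has_bounded_density a b v \<psi>" and "a < b"
    and "u a = v a" "u b = v b"
  shows "dist_K a b u v \<le> dist_I a b u v"
proof (cases "sup_norm a b (\<lambda>t. u t - v t) = \<infinity>")
  case True
  with \<open>a < b\<close> show ?thesis by (simp add: dist_I_def)
next
  case False
  define T where "T = sup_norm a b (\<lambda>t. u t - v t)"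
  have up: "ereal \<bar>u t - v t\<bar> \<le> T" if "t \<in> {a..b}" for t
    unfolding T_def sup_norm_def using that by (intro SUP_upper)
  \<comment> \<open>The value minus infinity is excluded because the interval is nonempty and
    \<open>T\<close> dominates an absolute value.\<close>
  then obtain S where S: "T = ereal S"
    using False \<open>a < b\<close> by (cases T) (force simp: T_def)+
  have "has_bounded_density a b (\<lambda>t. u t + (-1) * v t) (\<lambda>t. \<phi> t + (-1) * \<psi> t)"
    by (intro has_bounded_density_add has_bounded_density_cmult u v)
  then have w: "has_bounded_density a b (\<lambda>t. u t - v t) (\<lambda>t. \<phi> t - \<psi> t)" by simp
  have "stieltjes_integral a b f u - stieltjes_integral a b f v \<le> (b - a) * S"
    if f: "1-lipschitz_on {a..b} f" for f
  proof -
    have cont: "continuous_on {a..b} f" using f by (rule lipschitz_on_continuous_on)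
    have "stieltjes_integral a b f u - stieltjes_integral a b f v
      = integral {a..b} (\<lambda>t. f t * \<phi> t) - integral {a..b} (\<lambda>t. f t * \<psi> t)"
      using stieltjes_integral_density[OF u f] stieltjes_integral_density[OF v f] \<open>a < b\<close> by simp
    also have "\<dots> = integral {a..b} (\<lambda>t. f t * (\<phi> t - \<psi> t))"
      using has_bounded_density_integrable_sub[OF u cont subset_refl]
        has_bounded_density_integrable_sub[OF v cont subset_refl]
      by (simp add: right_diff_distrib Henstock_Kurzweil_Integration.integral_diff)
    also have "\<dots> \<le> (b - a) * S"
      using density_integral_le_sup_norm[OF w f, of S] up S assms by fastforce
    finally show ?thesis .
  qed
  then show ?thesis
    unfolding dist_K_def dist_I_def T_def[symmetric] S by (intro SUP_least) auto
qed

section \<open>Error bound and convergence of the utilities\<close>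

theorem theorem4p2:
  fixes N :: nat
    and x :: "nat \<Rightarrow> real"
    and xlo xhi \<delta> r0 :: real
    and A :: "real ^ 'n::{finite,linorder} ^ 'm::finite"
    and b :: "real ^ 'm"
    and vstar c0 :: "real ^ 'n::{finite,linorder}"
    and ustar :: "real \<Rightarrow> real"
    and P :: "nat \<Rightarrow> nat \<Rightarrow> (real ^ 'n::{finite,linorder}) set"
    and c :: "nat \<Rightarrow> real ^ 'n::{finite,linorder}"
    and \<alpha> :: "nat \<Rightarrow> nat \<Rightarrow> real ^ 'n::{finite,linorder}"
    and LA LB :: "nat \<Rightarrow> nat \<Rightarrow> real pmf"
    and U :: "nat \<Rightarrow> nat \<Rightarrow> (real \<Rightarrow> real) set"
  assumes "N = CARD('n) + 1" and "N \<ge> 3"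
    and "strict_mono_on {1..N + 1} x" and "x 1 = xlo" and "x (N + 1) = xhi"
    and "\<delta> = xhi - xlo"
    and "bounded (polyhedron0 A b)"
    and "vstar \<in> polyhedron0 A b"
    and "\<forall>t\<in>{xlo..xhi}. ustar t = pl_utility x vstar t"
    and "mono_on {xlo..xhi} ustar"
    and "cpm_run x vstar (polyhedron0 A b) P c \<alpha> LA LB"
    and "\<And>k i. U k i = pl_utilities x (P k i)"
    and "min_enclosing_ball (polyhedron0 A b) c0 r0"
  shows "(\<forall>k. \<forall>i\<in>{1..N - 1}. \<forall>u\<in>U k i.
            dist_K xlo xhi ustar u \<le> dist_I xlo xhi ustar u \<and>
            dist_I xlo xhi ustar u \<le> (SUP (u', u'')\<in>U k i \<times> U k i. dist_I xlo xhi u' u'') \<and>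
            (SUP (u', u'')\<in>U k i \<times> U k i. dist_I xlo xhi u' u'') =
              (SUP (u', u'')\<in>U k i \<times> U k i. ereal \<delta> * sup_norm xlo xhi (\<lambda>t. u' t - u'' t)) \<and>
            (SUP (u', u'')\<in>U k i \<times> U k i. ereal \<delta> * sup_norm xlo xhi (\<lambda>t. u' t - u'' t)) \<le>
              ereal (2 * \<delta> * sqrt (real N - 1) * r0
                       * (sqrt ((real N - 2) / (real N - 1))) ^ k)) \<and>
         (\<forall>i\<in>{1..N - 1}.
            (\<lambda>k. SUP u\<in>U k i. dist_K xlo xhi ustar u) \<longlonglongrightarrow> 0 \<and>
            (\<lambda>k. SUP u\<in>U k i. dist_I xlo xhi ustar u) \<longlonglongrightarrow> 0)"
proof -
  define q where "q = sqrt ((real N - 2) / (real N - 1))"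
  define R where "R k = 2 * \<delta> * sqrt (real N - 1) * r0 * q ^ k" for k
  \<comment> \<open>\<open>N \<ge> 3\<close> supplies the dimension of at least 2 that the shrinking
    of balls requires.\<close>
  have N: "N + 1 = CARD('n) + 2" "real N - 1 = real CARD('n)" "real N - 2 = real CARD('n) - 1"
    "N - 1 = CARD('n)" "2 \<le> CARD('n)"
    using assms(1,2) by auto
  have sm: "strict_mono_on {1..CARD('n) + 2} x" using assms(3) N(1) by simp
  have lo: "xlo = x 1" and hi: "xhi = x (CARD('n) + 2)" using assms(4,5) N(1) by auto
  have lt: "xlo < xhi" unfolding lo hi using sm by (auto simp: strict_mono_on_def)
  have \<delta>: "\<delta> > 0" using assms(6) lt by simp
  note run = assms(11)
  have U: "U k i = {u. \<exists>v\<in>P k i. \<forall>t\<in>{xlo..xhi}. u t = pl_utility x v t}" for k i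
    unfolding assms(12) pl_utilities_def lo hi ..
  have ustar: "ustar \<in> U k i" if "i \<in> {1..N - 1}" for k i
    using cpm_run_contains_truth[OF run assms(8), of i k] that N(4) assms(9) unfolding U by auto
  \<comment> \<open>Within an iteration only containment in its initial set is used, so the exponent
    is \<open>k\<close> for every \<open>i\<close>.\<close>
  have ball: "P k i \<subseteq> cball (c k) (r0 * q ^ k)" if "i \<in> {1..N - 1}" for k i
    using cpm_run_radius[OF run N(5) assms(13), of k] cpm_run_decseq[OF run, of 0 i k] that N
    unfolding q_def by auto
  \<comment> \<open>The factor 2 comes from the triangle inequality through the center
    \<open>c k\<close>, the root from comparing the 1-norm with the Euclidean norm.\<close>
  have sup_le: "sup_norm xlo xhi (\<lambda>t. u t - w t) \<le> ereal (2 * sqrt (real N - 1) * r0 * q ^ k)"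
    if i: "i \<in> {1..N - 1}" and "u \<in> U k i" "w \<in> U k i" for k i u w
    unfolding sup_norm_def
  proof (rule SUP_least)
    fix t assume t: "t \<in> {xlo..xhi}"
    obtain v v' where v: "v \<in> P k i" "u t = pl_utility x v t"
      and v': "v' \<in> P k i" "w t = pl_utility x v' t"
      using \<open>u \<in> U k i\<close> \<open>w \<in> U k i\<close> t unfolding U by blast
    have "dist v v' \<le> dist (c k) v + dist (c k) v'" by (rule dist_triangle3)
    also have "\<dots> \<le> 2 * (r0 * q ^ k)" using subsetD[OF ball[OF i] v(1)] subsetD[OF ball[OF i] v'(1)] by simp
    finally have "norm (v - v') \<le> 2 * (r0 * q ^ k)" by (simp add: dist_norm)
    then have "sqrt (real CARD('n)) * norm (v - v') \<le> sqrt (real CARD('n)) * (2 * (r0 * q ^ k))"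
      by (intro mult_left_mono) auto
    moreover have "\<bar>u t - w t\<bar> \<le> sqrt (real CARD('n)) * norm (v - v')"
      using pl_utility_diff_le[OF sm, of t v v'] t by (simp add: v v' lo hi)
    ultimately have "\<bar>u t - w t\<bar> \<le> sqrt (real CARD('n)) * (2 * (r0 * q ^ k))" by linarith
    then show "ereal \<bar>u t - w t\<bar> \<le> ereal (2 * sqrt (real N - 1) * r0 * q ^ k)"
      unfolding N(2) by (simp only: ereal_less_eq mult_ac)
  qed
  have dI_le: "ereal \<delta> * sup_norm xlo xhi (\<lambda>t. u t - w t) \<le> ereal (R k)"
    if "i \<in> {1..N - 1}" "u \<in> U k i" "w \<in> U k i" for k i u w
  proof -
    have "ereal \<delta> * sup_norm xlo xhi (\<lambda>t. u t - w t)
      \<le> ereal \<delta> * ereal (2 * sqrt (real N - 1) * r0 * q ^ k)"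
      using \<delta> by (intro ereal_mult_left_mono sup_le[OF that]) auto
    then show ?thesis by (simp add: R_def algebra_simps)
  qed
  have dI: "dist_I xlo xhi u w = ereal \<delta> * sup_norm xlo xhi (\<lambda>t. u t - w t)" for u w
    by (simp add: dist_I_def assms(6))
  \<comment> \<open>Members of \<open>U k i\<close> are specified only on the interval, so the
    density is transferred from \<open>pl_utility\<close> by congruence. The common endpoint values
    make differences vanish at both ends.\<close>
  have density: "\<exists>\<phi>. has_bounded_density xlo xhi u \<phi>" "u xlo = 0" "u xhi = 1"
    if u: "u \<in> U k i" for u k i
  proof -
    obtain v :: "real ^ 'n::{finite,linorder}"
      where v: "\<forall>t\<in>{xlo..xhi}. u t = pl_utility x v t" using u unfolding U by blast
    obtain \<phi> where "has_bounded_density xlo xhi (pl_utility x v) \<phi>"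
      using pl_utility_has_bounded_density[OF sm, of v] unfolding lo hi by blast
    from has_bounded_density_cong[OF this, of u] v show "\<exists>\<phi>. has_bounded_density xlo xhi u \<phi>" by auto
    show "u xlo = 0" "u xhi = 1"
      using v lt pl_utility_endpoints[OF sm, of v] unfolding lo hi by auto
  qed
  have KI: "dist_K xlo xhi ustar u \<le> dist_I xlo xhi ustar u"
    if "i \<in> {1..N - 1}" "u \<in> U k i" for u k i
    using density[OF that(2)] density[OF ustar[OF that(1), of k]] lt dist_K_le_dist_I by metis
  have q: "0 \<le> q" "q < 1" using assms(2) by (auto simp: q_def)
  have "R \<longlonglongrightarrow> 2 * \<delta> * sqrt (real N - 1) * r0 * 0"
    unfolding R_def using q by (intro tendsto_intros LIMSEQ_realpow_zero)
  then have R0: "(\<lambda>k. ereal (R k)) \<longlonglongrightarrow> 0"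
    by (simp add: zero_ereal_def)
  have I_le: "(SUP u\<in>U k i. dist_I xlo xhi ustar u) \<le> ereal (R k)" if "i \<in> {1..N - 1}" for k i
    using dI_le[OF that ustar[OF that]] by (intro SUP_least) (simp add: dI)
  have K_le: "(SUP u\<in>U k i. dist_K xlo xhi ustar u) \<le> (SUP u\<in>U k i. dist_I xlo xhi ustar u)"
    if "i \<in> {1..N - 1}" for k i
    using KI[OF that] by (intro SUP_mono) blast
  \<comment> \<open>The lower bound for both limits: \<open>ustar\<close> belongs to
    \<open>U k i\<close>, so the supremum is not over the empty set, and the zero test function
    gives its distance to itself the lower bound 0.\<close>
  have K_nonneg: "0 \<le> (SUP u\<in>U k i. dist_K xlo xhi ustar u)" if "i \<in> {1..N - 1}" for k i
  proof -
    have "1-lipschitz_on {xlo..xhi} (\<lambda>_. 0 :: real)" by (simp add: lipschitz_on_def)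
    then have "0 \<le> dist_K xlo xhi ustar ustar"
      unfolding dist_K_def by (intro SUP_upper2[of "\<lambda>_. 0"]) auto
    then show ?thesis by (rule SUP_upper2[OF ustar[OF that]])
  qed
  show ?thesis
  proof (intro conjI ballI allI)
    fix k i u assume i: "i \<in> {1..N - 1}" and u: "u \<in> U k i"
    show "dist_K xlo xhi ustar u \<le> dist_I xlo xhi ustar u" by (rule KI[OF i u])
    show "dist_I xlo xhi ustar u \<le> (SUP (u', u'')\<in>U k i \<times> U k i. dist_I xlo xhi u' u'')"
      by (rule SUP_upper2[of "(ustar, u)"]) (use ustar[OF i] u in auto)
    show "(SUP (u', u'')\<in>U k i \<times> U k i. dist_I xlo xhi u' u'') =
              (SUP (u', u'')\<in>U k i \<times> U k i. ereal \<delta> * sup_norm xlo xhi (\<lambda>t. u' t - u'' t))"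
      unfolding dI ..
    show "(SUP (u', u'')\<in>U k i \<times> U k i. ereal \<delta> * sup_norm xlo xhi (\<lambda>t. u' t - u'' t)) \<le>
              ereal (2 * \<delta> * sqrt (real N - 1) * r0 * (sqrt ((real N - 2) / (real N - 1))) ^ k)"
      using dI_le[OF i, of _ k] unfolding R_def q_def by (intro SUP_least) auto
  next
    fix i assume i: "i \<in> {1..N - 1}"
    show "(\<lambda>k. SUP u\<in>U k i. dist_I xlo xhi ustar u) \<longlonglongrightarrow> 0"
      by (rule tendsto_sandwich[OF _ _ tendsto_const R0])
        (use I_le[OF i] order_trans[OF K_nonneg[OF i] K_le[OF i]] in auto)
    show "(\<lambda>k. SUP u\<in>U k i. dist_K xlo xhi ustar u) \<longlonglongrightarrow> 0"
      by (rule tendsto_sandwich[OF _ _ tendsto_const R0])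
        (use order_trans[OF K_le[OF i] I_le[OF i]] K_nonneg[OF i] in auto)
  qed
qed

end
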